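(* Let $A_1,\dots,A_k$ be shifts such that $Y^{A_i}$ and $X^{A_i}$ are square integrable for each $i$, and suppose that $Y^0$ and $X^0$ (zero shift) are also square integrable. Let $\mathcal{A}$ be any set of shifts containing $A_1,\dots,A_k$ and let $$C(A_1,\dots,A_k)=\left\{A\in\mathcal{A}:\ \exists\,1\le i\le k,\ \mathbb{E}[AA^T\mid B]\preccurlyeq\mathbb{E}[A_iA_i^T\mid B]\ \text{a.s.}\right\}.$$ Then for every $\beta\in\mathbb{R}^p$, $$\sup_{A\in C(A_1,\dots,A_k)}R_A(\beta)=\max_{1\le i\le k}R_{A_i}(\beta).$$
   Context: Let $(\Omega,\mathcal{F},\mathbb{P})$ be a probability space. Consider structural equation models of the form $$\begin{bmatrix} Y^A \\ X^A \end{bmatrix}=B(\omega)\begin{bmatrix} Y^A \\ X^A \end{bmatrix}+\epsilon_A+A,$$ where $B$ is a random real $(p+1)\times(p+1)$ matrix, the random vector $A\in\mathbb{R}^{p+1}$ is called a shift, $Y^A$ (real valued) and $X^A$ ($\mathbb{R}^p$-valued) are the target and covariates in the environment shifted by $A$, and $\epsilon_A\in\mathbb{R}^{p+1}$ is a noise vector. The vectors $\epsilon_A$ have the same distribution for all $A$ and are conditionally uncorrelated with the shifts given $B$: $\mathbb{E}[\epsilon_AA^T\mid B]=0$. It is assumed that $I-B$ has full rank a.s., so that $(Y^A,X^A)$ is uniquely determined for every $A$. The risk associated with the shift $A$ is $R_A(\beta)=\mathbb{E}[(Y^A-\beta X^A)^2]$ for a row vector $\beta\in\mathbb{R}^p$.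 $\preccurlyeq$ denotes the positive semidefinite (Loewner) order.
   Formalization: "Same distribution for all A" of the noise is strengthened: the joint law of (ε_A, B), i.e. the conditional law of ε_A given B, is assumed not to depend on A. With equal marginal laws of ε_A only, the claim is false. *)

theory Defs
  imports "HOL-Probability.Probability"
begin

definition sigma_of :: "'w measure \<Rightarrow> ('w \<Rightarrow> 'b::topological_space) \<Rightarrow> 'w measure" where
  "sigma_of M B = vimage_algebra (space M) B borel"

definition outer :: "real^'n \<Rightarrow> real^'m \<Rightarrow> real^'m^'n" where
  "outer u v = (\<chi> i j. u $ i * v $ j)"

(* Existence of the conditional expectation in the generalized sense, E[|f| | F] < \<infinity> a.s.
   Under this condition real_cond_exp is the finite difference E[f+ | F] - E[f- | F], as usual,
   although f itself need not be integrable. Shifts are not assumed to be square integrable;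
   only the solutions (Y, X) are. *)
definition cond_exp_exists :: "'w measure \<Rightarrow> 'w measure \<Rightarrow> ('w \<Rightarrow> real) \<Rightarrow> bool" where
  "cond_exp_exists M F f \<longleftrightarrow>
     f \<in> borel_measurable M \<and>
     (AE \<omega> in M. nn_cond_exp M F (\<lambda>\<omega>. ennreal \<bar>f \<omega>\<bar>) \<omega> < \<infinity>)"

definition mat_cond_exp_exists ::
  "'w measure \<Rightarrow> 'w measure \<Rightarrow> ('w \<Rightarrow> real^'n^'m) \<Rightarrow> bool" where
  "mat_cond_exp_exists M F Z \<longleftrightarrow> (\<forall>i j. cond_exp_exists M F (\<lambda>\<omega>. Z \<omega> $ i $ j))"

definition mat_cond_exp ::
  "'w measure \<Rightarrow> 'w measure \<Rightarrow> ('w \<Rightarrow> real^'n^'m) \<Rightarrow> 'w \<Rightarrow> real^'n^'m" where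
  "mat_cond_exp M F Z \<omega> = (\<chi> i j. real_cond_exp M F (\<lambda>\<omega>. Z \<omega> $ i $ j) \<omega>)"

definition pos_semidef :: "real^'n^'n \<Rightarrow> bool" where
  "pos_semidef P \<longleftrightarrow> transpose P = P \<and> (\<forall>v. 0 \<le> v \<bullet> (P *v v))"

definition loewner_le :: "real^'n^'n \<Rightarrow> real^'n^'n \<Rightarrow> bool" where
  "loewner_le P Q \<longleftrightarrow> pos_semidef (Q - P)"

(* The (p+1)-dimensional space is indexed by 'p option: None is the target coordinate,
   Some j the j-th covariate. *)
definition stack :: "real \<Rightarrow> real^'p \<Rightarrow> real^('p option)" where
  "stack y x = (\<chi> i. case i of None \<Rightarrow> y | Some j \<Rightarrow> x $ j)"

(* S is the collection of all shifts under consideration; the noise \<epsilon> and the solution (Y, X)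
   are indexed by the shift. "Same distribution" of the noise vectors is taken relative to B,
   i.e. the joint law of (\<epsilon> A, B) does not depend on A. *)
locale random_sem = prob_space M
  for M :: "'w measure"
    and B :: "'w \<Rightarrow> real^('p::finite option)^('p option)"
    and S :: "('w \<Rightarrow> real^('p option)) set"
    and \<epsilon> :: "('w \<Rightarrow> real^('p option)) \<Rightarrow> 'w \<Rightarrow> real^('p option)"
    and Y :: "('w \<Rightarrow> real^('p option)) \<Rightarrow> 'w \<Rightarrow> real"
    and X :: "('w \<Rightarrow> real^('p option)) \<Rightarrow> 'w \<Rightarrow> real^'p" +
  assumes measurable_B: "B \<in> borel_measurable M"
    and full_rank: "AE \<omega> in M. rank (mat 1 - B \<omega>) = CARD('p option)"
    and zero_shift: "(\<lambda>_. 0) \<in> S"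
    and measurable_shift: "A \<in> S \<Longrightarrow> A \<in> borel_measurable M"
    and measurable_noise: "A \<in> S \<Longrightarrow> \<epsilon> A \<in> borel_measurable M"
    and measurable_Y: "A \<in> S \<Longrightarrow> Y A \<in> borel_measurable M"
    and measurable_X: "A \<in> S \<Longrightarrow> X A \<in> borel_measurable M"
    and same_law: "A \<in> S \<Longrightarrow> A' \<in> S \<Longrightarrow>
      distr M (borel \<Otimes>\<^sub>M borel) (\<lambda>\<omega>. (\<epsilon> A \<omega>, B \<omega>)) =
      distr M (borel \<Otimes>\<^sub>M borel) (\<lambda>\<omega>. (\<epsilon> A' \<omega>, B \<omega>))"
    and uncorrelated_exists: "A \<in> S \<Longrightarrow>
      mat_cond_exp_exists M (sigma_of M B) (\<lambda>\<omega>. outer (\<epsilon> A \<omega>) (A \<omega>))"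
    and uncorrelated: "A \<in> S \<Longrightarrow>
      AE \<omega> in M. mat_cond_exp M (sigma_of M B) (\<lambda>\<omega>. outer (\<epsilon> A \<omega>) (A \<omega>)) \<omega> = 0"
    and structural_equation: "A \<in> S \<Longrightarrow>
      AE \<omega> in M. stack (Y A \<omega>) (X A \<omega>) = B \<omega> *v stack (Y A \<omega>) (X A \<omega>) + \<epsilon> A \<omega> + A \<omega>"

definition square_integrable :: "'w measure \<Rightarrow> ('w \<Rightarrow> 'b::euclidean_space) \<Rightarrow> bool" where
  "square_integrable M f \<longleftrightarrow> f \<in> borel_measurable M \<and> integrable M (\<lambda>\<omega>. (norm (f \<omega>))\<^sup>2)"

(* Expectation of a nonnegative variable, with values in [0, \<infinity>], so that suprema of risks
   need no side conditions. *)
definition risk :: "'w measure \<Rightarrow> ('w \<Rightarrow> real) \<Rightarrow> ('w \<Rightarrow> real^'p) \<Rightarrow> real^'p \<Rightarrow> ennreal" where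
  "risk M y x \<beta> = (\<integral>\<^sup>+ \<omega>. ennreal ((y \<omega> - \<beta> \<bullet> x \<omega>)\<^sup>2) \<partial>M)"

definition second_moment_le ::
  "'w measure \<Rightarrow> 'w measure \<Rightarrow> ('w \<Rightarrow> real^'n) \<Rightarrow> ('w \<Rightarrow> real^'n) \<Rightarrow> bool" where
  "second_moment_le M F A A' \<longleftrightarrow>
     mat_cond_exp_exists M F (\<lambda>\<omega>. outer (A \<omega>) (A \<omega>)) \<and>
     mat_cond_exp_exists M F (\<lambda>\<omega>. outer (A' \<omega>) (A' \<omega>)) \<and>
     (AE \<omega> in M. loewner_le (mat_cond_exp M F (\<lambda>\<omega>. outer (A \<omega>) (A \<omega>)) \<omega>)
                            (mat_cond_exp M F (\<lambda>\<omega>. outer (A' \<omega>) (A' \<omega>)) \<omega>))"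

definition shift_set ::
  "'w measure \<Rightarrow> ('w \<Rightarrow> real^'n^'n) \<Rightarrow> ('w \<Rightarrow> real^'n) set \<Rightarrow> nat \<Rightarrow>
   (nat \<Rightarrow> 'w \<Rightarrow> real^'n) \<Rightarrow> ('w \<Rightarrow> real^'n) set" where
  "shift_set M B \<A> k A =
     {A' \<in> \<A>. \<exists>i\<in>{1..k}. second_moment_le M (sigma_of M B) A' (A i)}"

end

theory Submission
  imports Defs
begin

text \<open>
  The residual $Y^A - \beta X^A$ is a linear functional of the state, and the state is
  $(I - B)^{-1} (\epsilon_A + A)$. Hence the residual equals $c\,(\epsilon_A + A)$ with
  $c = (1, -\beta)(I - B)^{-1}$, a random vector that depends on $B$ alone. Conditioning on
  $B$ therefore freezes $c$; the cross term vanishes because noise and shift are conditionally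
  uncorrelated, and what remains is
  \[ R_A(\beta) = R_0(\beta) + E\bigl[c \, E[A A^T \mid B] \, c^T\bigr], \]
  where the noise contributes the same amount $R_0(\beta)$ to every risk. This is
  \<open>risk_decomposition\<close>. The second summand is monotone in the Loewner order
  (\<open>risk_mono_second_moment\<close>), so no shift in the robustness set has a larger risk than all of
  $A_1, \dots, A_k$; and the supremum is attained because these shifts are themselves in the set.

  Two points need care. First, shifts and noise may fail to be square integrable, so
  $E[A A^T \mid B]$ is a generalized conditional expectation: the absolute values of the entries
  have almost surely finite conditional expectations. Such expectations are linear over functions
  of $B$, which is proved by cutting down to sets of the conditioning algebra on which the
  variables are integrable (\<open>cond_exp_exists_iff_localizable\<close>). Second, membership of $A_i$ in the
  robustness set includes the existence of $E[A_i A_i^T \mid B]$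
  (\<open>shift_second_moment_exists\<close>). The state of environment $A_i$ is square integrable, so
  $\epsilon_{A_i} + A_i = (I - B) Z$ has conditional second moments. The same reasoning for the
  zero shift gives those of $\epsilon_0$, and equality of the joint laws with $B$ gives those of
  $\epsilon_{A_i}$. The difference $A_i$ then has them too.
\<close>

section \<open>Generalized conditional expectations are linear over the conditioning algebra\<close>

lemma cond_exp_exists_measurable:
  "cond_exp_exists M F f \<Longrightarrow> f \<in> borel_measurable M"
  by (simp add: cond_exp_exists_def)

text \<open>Identities between generalized conditional expectations are proved on sets of the
  conditioning algebra where everything is integrable; this glues the pieces together.\<close>

lemma AE_eq_of_AE_eq_on_cover:
  fixes a b :: "'a \<Rightarrow> real" and G :: "nat \<Rightarrow> 'a set"
  assumes cover: "AE \<omega> in M. \<exists>n. \<omega> \<in> G n"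
    and eq: "\<And>n. AE \<omega> in M. indicator (G n) \<omega> * a \<omega> = indicator (G n) \<omega> * b \<omega>"
  shows "AE \<omega> in M. a \<omega> = b \<omega>"
proof -
  have "AE \<omega> in M. \<forall>n. indicator (G n) \<omega> * a \<omega> = indicator (G n) \<omega> * b \<omega>"
    unfolding AE_all_countable using eq by blast
  with cover show ?thesis
    by eventually_elim (metis indicator_simps(1) mult_1)
qed

context finite_measure_subalgebra
begin

text \<open>For the forward direction, the sublevel sets of $E[|f| \mid F]$ serve as the localizing
  sets: they belong to $F$, so the integral of $|f|$ over one of them is the integral of
  $E[|f| \mid F]$ over it, which is bounded. They exhaust the space because $E[|f| \mid F]$ is
  finite almost surely. Conversely, a finite integral of $E[|f| \mid F]$ over each localizing
  set forces it to be finite there.\<close>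

lemma cond_exp_exists_iff_localizable:
  assumes [measurable]: "f \<in> borel_measurable M"
  shows "cond_exp_exists M F f \<longleftrightarrow>
    (\<exists>G::nat \<Rightarrow> 'a set. range G \<subseteq> sets F \<and> (AE \<omega> in M. \<exists>n. \<omega> \<in> G n) \<and>
       (\<forall>n. integrable M (\<lambda>\<omega>. indicator (G n) \<omega> * f \<omega>)))"
    (is "_ \<longleftrightarrow> ?loc")
proof
  let ?E = "nn_cond_exp M F (\<lambda>\<omega>. ennreal \<bar>f \<omega>\<bar>)"
  assume ex: "cond_exp_exists M F f"
  define G where "G n = {\<omega> \<in> space F. ?E \<omega> \<le> of_nat n}" for n :: nat
  have G [measurable]: "G n \<in> sets F" for n
    unfolding G_def by measurable
  have GM [measurable]: "G n \<in> sets M" for n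
    using G subalg by (auto simp: subalgebra_def)
  have "AE \<omega> in M. \<exists>n. \<omega> \<in> G n"
  proof -
    have "AE \<omega> in M. ?E \<omega> < \<infinity>"
      using ex by (simp add: cond_exp_exists_def)
    with AE_space show ?thesis
    proof eventually_elim
      case (elim \<omega>)
      then obtain n :: nat where "?E \<omega> \<le> of_nat n"
        using ennreal_Ex_less_of_nat[of "?E \<omega>"] by (auto intro: less_imp_le)
      then show ?case
        using elim subalg by (auto simp: G_def subalgebra_def)
    qed
  qed
  moreover have "integrable M (\<lambda>\<omega>. indicator (G n) \<omega> * f \<omega>)" for n
  proof (rule integrableI_bounded)
    have "(\<integral>\<^sup>+\<omega>. ennreal (norm (indicator (G n) \<omega> * f \<omega>)) \<partial>M)
        = (\<integral>\<^sup>+\<omega>. indicator (G n) \<omega> * ennreal \<bar>f \<omega>\<bar> \<partial>M)"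
      by (intro nn_integral_cong) (auto split: split_indicator)
    also have "\<dots> = (\<integral>\<^sup>+\<omega>. indicator (G n) \<omega> * ?E \<omega> \<partial>M)"
      by (rule nn_cond_exp_intg[symmetric]) auto
    also have "\<dots> \<le> (\<integral>\<^sup>+\<omega>. of_nat n \<partial>M)"
      by (intro nn_integral_mono) (auto simp: G_def split: split_indicator)
    also have "\<dots> < \<infinity>"
      by (simp add: ennreal_mult_less_top less_top[symmetric] ennreal_mult_eq_top_iff)
    finally show "(\<integral>\<^sup>+\<omega>. ennreal (norm (indicator (G n) \<omega> * f \<omega>)) \<partial>M) < \<infinity>" .
  qed measurable
  ultimately show ?loc
    using G by blast
next
  let ?E = "nn_cond_exp M F (\<lambda>\<omega>. ennreal \<bar>f \<omega>\<bar>)"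
  assume ?loc
  then obtain G :: "nat \<Rightarrow> 'a set" where "range G \<subseteq> sets F"
    and cover: "AE \<omega> in M. \<exists>n. \<omega> \<in> G n"
    and int: "\<And>n. integrable M (\<lambda>\<omega>. indicator (G n) \<omega> * f \<omega>)"
    by blast
  then have G [measurable]: "G n \<in> sets F" for n
    by auto
  have GM [measurable]: "G n \<in> sets M" for n
    using G subalg by (auto simp: subalgebra_def)
  have "AE \<omega> in M. indicator (G n) \<omega> * ?E \<omega> \<noteq> \<infinity>" for n
  proof (rule nn_integral_PInf_AE)
    have "(\<integral>\<^sup>+\<omega>. indicator (G n) \<omega> * ?E \<omega> \<partial>M) = (\<integral>\<^sup>+\<omega>. indicator (G n) \<omega> * ennreal \<bar>f \<omega>\<bar> \<partial>M)"
      by (rule nn_cond_exp_intg) auto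
    also have "\<dots> = (\<integral>\<^sup>+\<omega>. ennreal (norm (indicator (G n) \<omega> * f \<omega>)) \<partial>M)"
      by (intro nn_integral_cong) (auto split: split_indicator)
    also have "\<dots> \<noteq> \<infinity>"
      using int[of n] by (auto simp: integrable_iff_bounded)
    finally show "(\<integral>\<^sup>+\<omega>. indicator (G n) \<omega> * ?E \<omega> \<partial>M) \<noteq> \<infinity>" .
  qed measurable
  then have "AE \<omega> in M. \<forall>n. indicator (G n) \<omega> * ?E \<omega> \<noteq> \<infinity>"
    by (simp add: AE_all_countable)
  with cover have "AE \<omega> in M. ?E \<omega> < \<infinity>"
    by eventually_elim (metis indicator_simps(1) less_top mult_1 infinity_ennreal_def)
  then show "cond_exp_exists M F f"
    by (simp add: cond_exp_exists_def)
qed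

lemma cond_exp_existsE_localizing:
  assumes "cond_exp_exists M F f"
  obtains G :: "nat \<Rightarrow> 'a set"
  where "\<And>n. G n \<in> sets F" "AE \<omega> in M. \<exists>n. \<omega> \<in> G n"
    "\<And>n. integrable M (\<lambda>\<omega>. indicator (G n) \<omega> * f \<omega>)"
  using assms iffD1[OF cond_exp_exists_iff_localizable[OF cond_exp_exists_measurable[OF assms]]]
  by blast

lemma cond_exp_exists_integrable:
  assumes "integrable M f"
  shows "cond_exp_exists M F f"
proof -
  have "space M \<in> sets F"
    using subalg by (metis sets.top subalgebra_def)
  moreover have "integrable M (\<lambda>\<omega>. indicator (space M) \<omega> * f \<omega>)"
    using integrable_mult_indicator[OF sets.top assms] by simp
  ultimately show ?thesis
    using assms by (subst cond_exp_exists_iff_localizable)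
      (auto intro!: exI[of _ "\<lambda>_. space M"])
qed

lemma cond_exp_exists_bound:
  assumes h: "cond_exp_exists M F h" and [measurable]: "f \<in> borel_measurable M"
    and le: "AE \<omega> in M. \<bar>f \<omega>\<bar> \<le> \<bar>h \<omega>\<bar>"
  shows "cond_exp_exists M F f"
proof -
  have "AE \<omega> in M. nn_cond_exp M F (\<lambda>\<omega>. ennreal \<bar>f \<omega>\<bar>) \<omega> \<le> nn_cond_exp M F (\<lambda>\<omega>. ennreal \<bar>h \<omega>\<bar>) \<omega>"
    using le h[THEN cond_exp_exists_measurable] by (intro nn_cond_exp_mono) auto
  moreover have "AE \<omega> in M. nn_cond_exp M F (\<lambda>\<omega>. ennreal \<bar>h \<omega>\<bar>) \<omega> < \<infinity>"
    using h by (simp add: cond_exp_exists_def)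
  ultimately have "AE \<omega> in M. nn_cond_exp M F (\<lambda>\<omega>. ennreal \<bar>f \<omega>\<bar>) \<omega> < \<infinity>"
    by eventually_elim (rule le_less_trans)
  then show ?thesis
    by (simp add: cond_exp_exists_def)
qed

lemma cond_exp_exists_weight:
  assumes f: "cond_exp_exists M F f" and [measurable]: "u \<in> borel_measurable F"
  shows "cond_exp_exists M F (\<lambda>\<omega>. u \<omega> * f \<omega>)"
proof -
  have [measurable]: "f \<in> borel_measurable M"
    using f by (rule cond_exp_exists_measurable)
  have [measurable]: "u \<in> borel_measurable M"
    using subalg by (rule measurable_from_subalg) measurable
  have "AE \<omega> in M. ennreal \<bar>u \<omega>\<bar> * nn_cond_exp M F (\<lambda>\<omega>. ennreal \<bar>f \<omega>\<bar>) \<omega>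
      = nn_cond_exp M F (\<lambda>\<omega>. ennreal \<bar>u \<omega>\<bar> * ennreal \<bar>f \<omega>\<bar>) \<omega>"
    by (rule nn_cond_exp_prod) auto
  moreover have "AE \<omega> in M. nn_cond_exp M F (\<lambda>\<omega>. ennreal \<bar>f \<omega>\<bar>) \<omega> < \<infinity>"
    using f by (simp add: cond_exp_exists_def)
  ultimately have "AE \<omega> in M. nn_cond_exp M F (\<lambda>\<omega>. ennreal \<bar>u \<omega> * f \<omega>\<bar>) \<omega> < \<infinity>"
  proof eventually_elim
    case (elim \<omega>)
    have "ennreal \<bar>u \<omega>\<bar> * nn_cond_exp M F (\<lambda>\<omega>. ennreal \<bar>f \<omega>\<bar>) \<omega> < \<infinity>"
      using elim(2) by (simp add: ennreal_mult_less_top)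
    then show ?case
      unfolding elim(1) by (simp add: abs_mult ennreal_mult)
  qed
  then show ?thesis
    by (simp add: cond_exp_exists_def)
qed

text \<open>Weights measurable with respect to $F$ pull out even when neither $f$ nor $u f$ is
  integrable: on each localizing set of $u f$, both sides come from one integrable product
  by pulling out either the indicator alone or the indicator times $u$.\<close>

lemma real_cond_exp_weight:
  assumes f: "cond_exp_exists M F f" and [measurable]: "u \<in> borel_measurable F"
  shows "AE \<omega> in M. real_cond_exp M F (\<lambda>\<omega>. u \<omega> * f \<omega>) \<omega> = u \<omega> * real_cond_exp M F f \<omega>"
proof -
  have [measurable]: "f \<in> borel_measurable M"
    using f by (rule cond_exp_exists_measurable)
  have [measurable]: "u \<in> borel_measurable M"
    using subalg by (rule measurable_from_subalg) measurable
  obtain G :: "nat \<Rightarrow> 'a set" where [measurable]: "\<And>n. G n \<in> sets F"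
    and cover: "AE \<omega> in M. \<exists>n. \<omega> \<in> G n"
    and int: "\<And>n. integrable M (\<lambda>\<omega>. indicator (G n) \<omega> * (u \<omega> * f \<omega>))"
    using cond_exp_existsE_localizing[OF cond_exp_exists_weight[OF assms]] by blast
  have "AE \<omega> in M. indicator (G n) \<omega> * real_cond_exp M F (\<lambda>\<omega>. u \<omega> * f \<omega>) \<omega>
      = indicator (G n) \<omega> * (u \<omega> * real_cond_exp M F f \<omega>)" for n
  proof -
    have "AE \<omega> in M. real_cond_exp M F (\<lambda>\<omega>. indicator (G n) \<omega> * (u \<omega> * f \<omega>)) \<omega>
        = indicator (G n) \<omega> * real_cond_exp M F (\<lambda>\<omega>. u \<omega> * f \<omega>) \<omega>"
      using int by (intro real_cond_exp_mult) auto
    moreover have "AE \<omega> in M. real_cond_exp M F (\<lambda>\<omega>. (indicator (G n) \<omega> * u \<omega>) * f \<omega>) \<omega>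
        = (indicator (G n) \<omega> * u \<omega>) * real_cond_exp M F f \<omega>"
      using int by (intro real_cond_exp_mult) (auto simp: mult.assoc)
    ultimately show ?thesis
      unfolding mult.assoc by eventually_elim auto
  qed
  with cover show ?thesis
    by (rule AE_eq_of_AE_eq_on_cover)
qed

text \<open>The sum of absolute values is needed so that a single sequence of localizing sets serves
  both summands.\<close>

lemma cond_exp_exists_add_abs:
  assumes f: "cond_exp_exists M F f" and g: "cond_exp_exists M F g"
  shows "cond_exp_exists M F (\<lambda>\<omega>. \<bar>f \<omega>\<bar> + \<bar>g \<omega>\<bar>)"
proof -
  note [measurable] = f[THEN cond_exp_exists_measurable] g[THEN cond_exp_exists_measurable]
  have "AE \<omega> in M. nn_cond_exp M F (\<lambda>\<omega>. ennreal \<bar>f \<omega>\<bar>) \<omega> + nn_cond_exp M F (\<lambda>\<omega>. ennreal \<bar>g \<omega>\<bar>) \<omega>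
      = nn_cond_exp M F (\<lambda>\<omega>. ennreal \<bar>f \<omega>\<bar> + ennreal \<bar>g \<omega>\<bar>) \<omega>"
    by (rule nn_cond_exp_sum) auto
  moreover have "AE \<omega> in M. nn_cond_exp M F (\<lambda>\<omega>. ennreal \<bar>f \<omega>\<bar>) \<omega> < \<infinity>"
    "AE \<omega> in M. nn_cond_exp M F (\<lambda>\<omega>. ennreal \<bar>g \<omega>\<bar>) \<omega> < \<infinity>"
    using f g by (simp_all add: cond_exp_exists_def)
  ultimately have "AE \<omega> in M. nn_cond_exp M F (\<lambda>\<omega>. ennreal \<bar>\<bar>f \<omega>\<bar> + \<bar>g \<omega>\<bar>\<bar>) \<omega> < \<infinity>"
    by eventually_elim (auto simp: less_top[symmetric] simp flip: ennreal_plus)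
  then show ?thesis
    by (simp add: cond_exp_exists_def)
qed

lemma cond_exp_exists_add:
  assumes f: "cond_exp_exists M F f" and g: "cond_exp_exists M F g"
  shows "cond_exp_exists M F (\<lambda>\<omega>. f \<omega> + g \<omega>)"
  using cond_exp_exists_add_abs[OF assms]
  by (rule cond_exp_exists_bound)
    (use assms[THEN cond_exp_exists_measurable] in auto)

lemma real_cond_exp_add_generalized:
  assumes f: "cond_exp_exists M F f" and g: "cond_exp_exists M F g"
  shows "AE \<omega> in M. real_cond_exp M F (\<lambda>\<omega>. f \<omega> + g \<omega>) \<omega> = real_cond_exp M F f \<omega> + real_cond_exp M F g \<omega>"
proof -
  note [measurable] = f[THEN cond_exp_exists_measurable] g[THEN cond_exp_exists_measurable]
  obtain G :: "nat \<Rightarrow> 'a set" where [measurable]: "\<And>n. G n \<in> sets F"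
    and cover: "AE \<omega> in M. \<exists>n. \<omega> \<in> G n"
    and int: "\<And>n. integrable M (\<lambda>\<omega>. indicator (G n) \<omega> * (\<bar>f \<omega>\<bar> + \<bar>g \<omega>\<bar>))"
    using cond_exp_existsE_localizing[OF cond_exp_exists_add_abs[OF assms]] by blast
  have GM [measurable]: "G n \<in> sets M" for n
    using subalg \<open>\<And>n. G n \<in> sets F\<close> by (auto simp: subalgebra_def)
  have intf: "integrable M (\<lambda>\<omega>. indicator (G n) \<omega> * f \<omega>)" for n
    by (rule Bochner_Integration.integrable_bound[OF int[of n]]) (auto split: split_indicator)
  have intg: "integrable M (\<lambda>\<omega>. indicator (G n) \<omega> * g \<omega>)" for n
    by (rule Bochner_Integration.integrable_bound[OF int[of n]]) (auto split: split_indicator)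
  have "AE \<omega> in M. indicator (G n) \<omega> * real_cond_exp M F (\<lambda>\<omega>. f \<omega> + g \<omega>) \<omega>
      = indicator (G n) \<omega> * (real_cond_exp M F f \<omega> + real_cond_exp M F g \<omega>)" for n
  proof -
    have "AE \<omega> in M. real_cond_exp M F (\<lambda>\<omega>. indicator (G n) \<omega> * (f \<omega> + g \<omega>)) \<omega>
        = indicator (G n) \<omega> * real_cond_exp M F (\<lambda>\<omega>. f \<omega> + g \<omega>) \<omega>"
      using intf[of n] intg[of n] by (intro real_cond_exp_mult) (auto simp: distrib_left)
    moreover have "AE \<omega> in M. real_cond_exp M F (\<lambda>\<omega>. indicator (G n) \<omega> * f \<omega>) \<omega>
        = indicator (G n) \<omega> * real_cond_exp M F f \<omega>"
      using intf[of n] by (intro real_cond_exp_mult) auto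
    moreover have "AE \<omega> in M. real_cond_exp M F (\<lambda>\<omega>. indicator (G n) \<omega> * g \<omega>) \<omega>
        = indicator (G n) \<omega> * real_cond_exp M F g \<omega>"
      using intg[of n] by (intro real_cond_exp_mult) auto
    moreover have "AE \<omega> in M. real_cond_exp M F (\<lambda>\<omega>. indicator (G n) \<omega> * f \<omega> + indicator (G n) \<omega> * g \<omega>) \<omega>
        = real_cond_exp M F (\<lambda>\<omega>. indicator (G n) \<omega> * f \<omega>) \<omega> + real_cond_exp M F (\<lambda>\<omega>. indicator (G n) \<omega> * g \<omega>) \<omega>"
      using intf[of n] intg[of n] by (rule real_cond_exp_add)
    ultimately show ?thesis
      by eventually_elim (simp add: distrib_left)
  qed
  with cover show ?thesis
    by (rule AE_eq_of_AE_eq_on_cover)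
qed

lemma cond_exp_sum_generalized:
  assumes "finite I" and "\<And>i. i \<in> I \<Longrightarrow> cond_exp_exists M F (f i)"
  shows "cond_exp_exists M F (\<lambda>\<omega>. \<Sum>i\<in>I. f i \<omega>) \<and>
    (AE \<omega> in M. real_cond_exp M F (\<lambda>\<omega>. \<Sum>i\<in>I. f i \<omega>) \<omega> = (\<Sum>i\<in>I. real_cond_exp M F (f i) \<omega>))"
  using assms
proof (induction I rule: finite_induct)
  case empty
  have "AE \<omega> in M. real_cond_exp M F (\<lambda>\<omega>. 0) \<omega> = 0"
    by (rule real_cond_exp_F_meas) auto
  then show ?case
    by (auto intro: cond_exp_exists_integrable)
next
  case (insert i I)
  then have IH: "cond_exp_exists M F (\<lambda>\<omega>. \<Sum>i\<in>I. f i \<omega>)"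
    "AE \<omega> in M. real_cond_exp M F (\<lambda>\<omega>. \<Sum>i\<in>I. f i \<omega>) \<omega> = (\<Sum>i\<in>I. real_cond_exp M F (f i) \<omega>)"
    and fi: "cond_exp_exists M F (f i)"
    by auto
  have "AE \<omega> in M. real_cond_exp M F (\<lambda>\<omega>. f i \<omega> + (\<Sum>i\<in>I. f i \<omega>)) \<omega>
      = real_cond_exp M F (f i) \<omega> + (\<Sum>i\<in>I. real_cond_exp M F (f i) \<omega>)"
    using real_cond_exp_add_generalized[OF fi IH(1)] IH(2) by eventually_elim simp
  then show ?case
    using insert.hyps cond_exp_exists_add[OF fi IH(1)] by simp
qed

text \<open>The bound dominates the product $f g$ as well as the square of $f - g$. It therefore
  supplies mixed moments from pure ones, and the moments of a shift from those of the noise and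
  of the noise plus the shift.\<close>

lemma cond_exp_exists_square_bound:
  assumes f: "cond_exp_exists M F (\<lambda>\<omega>. (f \<omega>)\<^sup>2)" and g: "cond_exp_exists M F (\<lambda>\<omega>. (g \<omega>)\<^sup>2)"
    and h: "h \<in> borel_measurable M" "AE \<omega> in M. \<bar>h \<omega>\<bar> \<le> 2 * (f \<omega>)\<^sup>2 + 2 * (g \<omega>)\<^sup>2"
  shows "cond_exp_exists M F h"
  using cond_exp_exists_add[OF cond_exp_exists_weight[OF f, of "\<lambda>_. 2"] cond_exp_exists_weight[OF g, of "\<lambda>_. 2"]]
  by (rule cond_exp_exists_bound) (use h in auto)

lemma mat_cond_exp_existsI_squares:
  fixes P :: "'a \<Rightarrow> real^'n"
  assumes P: "\<And>i. (\<lambda>\<omega>. P \<omega> $ i) \<in> borel_measurable M"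
    and sq: "\<And>i. cond_exp_exists M F (\<lambda>\<omega>. (P \<omega> $ i)\<^sup>2)"
  shows "mat_cond_exp_exists M F (\<lambda>\<omega>. outer (P \<omega>) (P \<omega>))"
proof -
  note [measurable] = P
  have "\<bar>x * y\<bar> \<le> 2 * x\<^sup>2 + 2 * y\<^sup>2" for x y :: real
  proof -
    have "2 * \<bar>x * y\<bar> \<le> x\<^sup>2 + y\<^sup>2"
      using zero_le_power2[of "\<bar>x\<bar> - \<bar>y\<bar>"] by (simp add: power2_diff abs_mult)
    with zero_le_power2[of x] zero_le_power2[of y] show ?thesis
      by linarith
  qed
  then have "cond_exp_exists M F (\<lambda>\<omega>. P \<omega> $ i * P \<omega> $ j)" for i j
    by (intro cond_exp_exists_square_bound[OF sq[of i] sq[of j]] AE_I2) auto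
  then show ?thesis
    by (simp add: mat_cond_exp_exists_def outer_def)
qed

text \<open>This is what allows the argument to read off the quadratic form of a conditional
  moment matrix at a random direction $c$, provided $c$ is known given $F$: expanding both
  inner products gives a finite sum of entries with weights measurable with respect to
  $F$.\<close>

lemma cond_exp_inner_times_inner:
  fixes P Q c :: "'a \<Rightarrow> real^'n"
  assumes ex: "mat_cond_exp_exists M F (\<lambda>\<omega>. outer (P \<omega>) (Q \<omega>))"
    and c: "\<And>j. (\<lambda>\<omega>. c \<omega> $ j) \<in> borel_measurable F"
  shows cond_exp_exists_inner_times_inner: "cond_exp_exists M F (\<lambda>\<omega>. (c \<omega> \<bullet> P \<omega>) * (c \<omega> \<bullet> Q \<omega>))"
    and real_cond_exp_inner_times_inner: "AE \<omega> in M. real_cond_exp M F (\<lambda>\<omega>. (c \<omega> \<bullet> P \<omega>) * (c \<omega> \<bullet> Q \<omega>)) \<omega>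
      = c \<omega> \<bullet> (mat_cond_exp M F (\<lambda>\<omega>. outer (P \<omega>) (Q \<omega>)) \<omega> *v c \<omega>)"
proof -
  note [measurable] = c
  let ?t = "\<lambda>z \<omega>. (c \<omega> $ fst z * c \<omega> $ snd z) * (P \<omega> $ fst z * Q \<omega> $ snd z)"
  have entry: "cond_exp_exists M F (\<lambda>\<omega>. P \<omega> $ j * Q \<omega> $ k)" for j k
    using ex by (simp add: mat_cond_exp_exists_def outer_def)
  have t: "cond_exp_exists M F (?t z)"
    "AE \<omega> in M. real_cond_exp M F (?t z) \<omega>
      = (c \<omega> $ fst z * c \<omega> $ snd z) * real_cond_exp M F (\<lambda>\<omega>. P \<omega> $ fst z * Q \<omega> $ snd z) \<omega>" for z
    by (rule cond_exp_exists_weight[OF entry], measurable)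
       (rule real_cond_exp_weight[OF entry], measurable)
  have expand: "(\<lambda>\<omega>. (c \<omega> \<bullet> P \<omega>) * (c \<omega> \<bullet> Q \<omega>)) = (\<lambda>\<omega>. \<Sum>z\<in>UNIV. ?t z \<omega>)"
    by (simp add: inner_vec_def sum_product sum.cartesian_product ac_simps case_prod_beta)
  note sum = cond_exp_sum_generalized[of UNIV ?t, OF _ t(1), simplified]
  show "cond_exp_exists M F (\<lambda>\<omega>. (c \<omega> \<bullet> P \<omega>) * (c \<omega> \<bullet> Q \<omega>))"
    unfolding expand using sum by blast
  have "AE \<omega> in M. \<forall>z. real_cond_exp M F (?t z) \<omega>
      = (c \<omega> $ fst z * c \<omega> $ snd z) * real_cond_exp M F (\<lambda>\<omega>. P \<omega> $ fst z * Q \<omega> $ snd z) \<omega>"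
    unfolding AE_all_countable using t(2) by blast
  with sum[THEN conjunct2]
  show "AE \<omega> in M. real_cond_exp M F (\<lambda>\<omega>. (c \<omega> \<bullet> P \<omega>) * (c \<omega> \<bullet> Q \<omega>)) \<omega>
      = c \<omega> \<bullet> (mat_cond_exp M F (\<lambda>\<omega>. outer (P \<omega>) (Q \<omega>)) \<omega> *v c \<omega>)"
    unfolding expand
  proof eventually_elim
    case (elim \<omega>)
    then show ?case
      by (simp add: inner_vec_def matrix_vector_mult_def mat_cond_exp_def outer_def
          sum_distrib_left sum.cartesian_product case_prod_beta ac_simps)
  qed
qed

lemma ennreal_real_cond_exp:
  assumes f: "cond_exp_exists M F f" and nonneg: "AE \<omega> in M. 0 \<le> f \<omega>"
  shows "AE \<omega> in M. 0 \<le> real_cond_exp M F f \<omega> \<and>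
      ennreal (real_cond_exp M F f \<omega>) = nn_cond_exp M F (\<lambda>\<omega>. ennreal (f \<omega>)) \<omega>"
proof -
  note [measurable] = f[THEN cond_exp_exists_measurable]
  have "AE \<omega> in M. nn_cond_exp M F (\<lambda>\<omega>. ennreal (- f \<omega>)) \<omega> = nn_cond_exp M F (\<lambda>\<omega>. 0) \<omega>"
    using nonneg by (intro nn_cond_exp_cong) (auto simp: ennreal_neg)
  moreover have "AE \<omega> in M. 0 = nn_cond_exp M F (\<lambda>\<omega>. 0) \<omega>"
    by (rule nn_cond_exp_F_meas) simp
  moreover have "AE \<omega> in M. nn_cond_exp M F (\<lambda>\<omega>. ennreal (f \<omega>)) \<omega> = nn_cond_exp M F (\<lambda>\<omega>. ennreal \<bar>f \<omega>\<bar>) \<omega>"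
    using nonneg by (intro nn_cond_exp_cong) auto
  moreover have "AE \<omega> in M. nn_cond_exp M F (\<lambda>\<omega>. ennreal \<bar>f \<omega>\<bar>) \<omega> < \<infinity>"
    using f by (simp add: cond_exp_exists_def)
  ultimately show ?thesis
    by eventually_elim (auto simp: real_cond_exp_def)
qed

text \<open>The tower property with values in $[0, \infty]$: existence of the conditional expectation
  suffices, and both sides may be infinite.\<close>

lemma nn_integral_real_cond_exp:
  assumes f: "cond_exp_exists M F f" and nonneg: "AE \<omega> in M. 0 \<le> f \<omega>"
  shows "(\<integral>\<^sup>+\<omega>. ennreal (real_cond_exp M F f \<omega>) \<partial>M) = (\<integral>\<^sup>+\<omega>. ennreal (f \<omega>) \<partial>M)"
proof -
  note [measurable] = f[THEN cond_exp_exists_measurable]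
  have "(\<integral>\<^sup>+\<omega>. ennreal (real_cond_exp M F f \<omega>) \<partial>M)
      = (\<integral>\<^sup>+\<omega>. 1 * nn_cond_exp M F (\<lambda>\<omega>. ennreal (f \<omega>)) \<omega> \<partial>M)"
    using ennreal_real_cond_exp[OF assms] by (intro nn_integral_cong_AE) auto
  also have "\<dots> = (\<integral>\<^sup>+\<omega>. 1 * ennreal (f \<omega>) \<partial>M)"
    by (rule nn_cond_exp_intg) auto
  finally show ?thesis by simp
qed

end


section \<open>Linear algebra of the structural equation\<close>

lemma borel_measurable_det:
  "(\<lambda>m. det (m::real^'n^'n)) \<in> borel_measurable borel"
  unfolding det_def
  by (intro borel_measurable_continuous_onI continuous_intros)

lemma borel_measurable_vec_lambda:
  fixes f :: "'n::finite \<Rightarrow> 'a \<Rightarrow> real"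
  assumes "\<And>i. f i \<in> borel_measurable N"
  shows "(\<lambda>x. \<chi> i. f i x) \<in> borel_measurable N"
  using assms
  by (subst borel_measurable_euclidean_space) (auto simp: Basis_vec_def inner_axis)

lemma measurable_component:
  fixes P :: "'a \<Rightarrow> real^'n"
  assumes "P \<in> borel_measurable N"
  shows "(\<lambda>x. P x $ i) \<in> borel_measurable N"
  using assms by (rule measurable_compose) (intro borel_measurable_continuous_onI continuous_intros)

text \<open>Cramer's rule gives the solution of $g\, m = w$ as a quotient of determinants, hence as a
  Borel function of the matrix. Measurability of $g$ is what keeps $g(I - B)$ a function known given $B$.\<close>

lemma borel_measurable_left_solution:
  fixes w :: "real^'n"
  obtains g :: "real^'n^'n \<Rightarrow> real^'n"
  where "g \<in> borel_measurable borel"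
    "\<And>m. rank m = CARD('n) \<Longrightarrow> g m v* m = w"
proof
  define D where "D m k = det (\<chi> i j. if j = k then w $ i else (transpose m) $ i $ j)" for m :: "real^'n^'n" and k
  let ?g = "\<lambda>m::real^'n^'n. \<chi> k. D m k / det (transpose m)"
  have D: "(\<lambda>m. D m k) \<in> borel_measurable borel" for k
  proof -
    have "continuous_on UNIV (\<lambda>m::real^'n^'n. if j = k then w $ i else m $ j $ i)" for i j
      by (cases "j = k") (auto intro!: continuous_intros)
    then show ?thesis
      unfolding D_def det_def transpose_def vec_lambda_beta
      by (intro borel_measurable_continuous_onI continuous_intros) simp
  qed
  show "?g \<in> borel_measurable borel"
    by (intro borel_measurable_vec_lambda borel_measurable_divide D)
      (simp add: borel_measurable_det)
  fix m :: "real^'n^'n"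
  assume "rank m = CARD('n)"
  then have "\<exists>m'. m' ** transpose m = mat 1"
    by (simp add: matrix_left_invertible_injective full_rank_injective[symmetric] rank_transpose)
  then have "det (transpose m) \<noteq> 0"
    unfolding invertible_det_nz[symmetric] invertible_left_inverse .
  then have "transpose m *v ?g m = w"
    unfolding D_def by (rule iffD2[OF cramer]) (rule refl)
  then show "?g m v* m = w"
    by simp
qed

lemma inner_stack:
  "stack a u \<bullet> stack b v = a * b + u \<bullet> v"
  by (simp add: inner_vec_def stack_def UNIV_option_conv sum.reindex)


section \<open>Second moments and risks in the random structural equation model\<close>

lemma subalgebra_sigma_of:
  assumes "B \<in> borel_measurable M"
  shows "subalgebra M (sigma_of M B)"
  using assms by (auto simp: subalgebra_def sigma_of_def sets_vimage_algebra2 measurable_sets)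

context random_sem
begin

sublocale finite_measure_subalgebra M "sigma_of M B"
  by unfold_locales (rule subalgebra_sigma_of[OF measurable_B])

lemma measurable_sigma_of_B: "B \<in> borel_measurable (sigma_of M B)"
  unfolding sigma_of_def by (rule measurable_vimage_algebra1) simp

lemma nn_integral_noise_cong:
  assumes "A \<in> S" "A' \<in> S" and \<phi>: "\<phi> \<in> borel_measurable (borel \<Otimes>\<^sub>M borel)"
  shows "(\<integral>\<^sup>+\<omega>. \<phi> (\<epsilon> A \<omega>, B \<omega>) \<partial>M) = (\<integral>\<^sup>+\<omega>. \<phi> (\<epsilon> A' \<omega>, B \<omega>) \<partial>M)"
proof -
  have law: "(\<integral>\<^sup>+\<omega>. \<phi> (\<epsilon> D \<omega>, B \<omega>) \<partial>M) = integral\<^sup>N (distr M (borel \<Otimes>\<^sub>M borel) (\<lambda>\<omega>. (\<epsilon> D \<omega>, B \<omega>))) \<phi>"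
    if "D \<in> S" for D
    using \<phi> measurable_noise[OF that] measurable_B by (subst nn_integral_distr) auto
  show ?thesis
    by (simp add: law assms(1,2) same_law[OF assms(1,2)])
qed

text \<open>Every set of the algebra generated by $B$ is a preimage under $B$, so localizing
  sets for one noise vector are described through $B$ alone and, by equality of the joint
  laws with $B$, localize every other noise vector as well.\<close>

lemma cond_exp_exists_noise_cong:
  assumes "A \<in> S" "A' \<in> S" and [measurable]: "\<psi> \<in> borel_measurable borel"
    and ex: "cond_exp_exists M (sigma_of M B) (\<lambda>\<omega>. \<psi> (\<epsilon> A \<omega>))"
  shows "cond_exp_exists M (sigma_of M B) (\<lambda>\<omega>. \<psi> (\<epsilon> A' \<omega>))"
proof -
  note [measurable] = measurable_noise[OF \<open>A \<in> S\<close>] measurable_noise[OF \<open>A' \<in> S\<close>] measurable_B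
  obtain G :: "nat \<Rightarrow> 'w set" where G: "\<And>n. G n \<in> sets (sigma_of M B)"
    and cover: "AE \<omega> in M. \<exists>n. \<omega> \<in> G n"
    and int: "\<And>n. integrable M (\<lambda>\<omega>. indicator (G n) \<omega> * \<psi> (\<epsilon> A \<omega>))"
    using cond_exp_existsE_localizing[OF ex] by blast
  have "integrable M (\<lambda>\<omega>. indicator (G n) \<omega> * \<psi> (\<epsilon> A' \<omega>))" for n
  proof -
    obtain H where [measurable]: "H \<in> sets borel" and H: "G n = B -` H \<inter> space M"
      using G[of n] by (auto simp: sigma_of_def sets_vimage_algebra2)
    have [measurable]: "G n \<in> sets M"
      unfolding H by measurable
    have *: "(\<integral>\<^sup>+\<omega>. ennreal (norm (indicator (G n) \<omega> * \<psi> (\<epsilon> D \<omega>))) \<partial>M)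
        = (\<integral>\<^sup>+\<omega>. (\<lambda>(e, b). ennreal (norm (indicator H b * \<psi> e))) (\<epsilon> D \<omega>, B \<omega>) \<partial>M)" for D
      by (intro nn_integral_cong) (auto simp: H split: split_indicator)
    have "(\<integral>\<^sup>+\<omega>. ennreal (norm (indicator (G n) \<omega> * \<psi> (\<epsilon> A' \<omega>))) \<partial>M)
        = (\<integral>\<^sup>+\<omega>. ennreal (norm (indicator (G n) \<omega> * \<psi> (\<epsilon> A \<omega>))) \<partial>M)"
      unfolding * by (rule nn_integral_noise_cong[OF \<open>A' \<in> S\<close> \<open>A \<in> S\<close>]) measurable
    also have "\<dots> < \<infinity>"
      using int[of n] by (simp add: integrable_iff_bounded)
    finally show ?thesis
      by (intro integrableI_bounded) measurable
  qed
  with G cover show ?thesis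
    by (subst cond_exp_exists_iff_localizable) (measurable, blast)
qed

abbreviation state :: "('w \<Rightarrow> real^('p option)) \<Rightarrow> 'w \<Rightarrow> real^('p option)" where
  "state A \<omega> \<equiv> stack (Y A \<omega>) (X A \<omega>)"

lemma AE_inverse_structural_equation:
  assumes "A \<in> S"
  shows "AE \<omega> in M. (mat 1 - B \<omega>) *v state A \<omega> = \<epsilon> A \<omega> + A \<omega>"
  using structural_equation[OF assms]
  by eventually_elim (simp add: matrix_vector_mult_diff_rdistrib algebra_simps)

text \<open>Square integrability is assumed of the solution only, so every moment of noise and shift
  has to be traced back to these moments of the state.\<close>

lemma state_second_moment_exists:
  assumes "square_integrable M (Y A)" "square_integrable M (X A)"
  shows "mat_cond_exp_exists M (sigma_of M B) (\<lambda>\<omega>. outer (state A \<omega>) (state A \<omega>))"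
proof (rule mat_cond_exp_existsI_squares)
  have meas [measurable]: "Y A \<in> borel_measurable M" "X A \<in> borel_measurable M"
    using assms by (auto simp: square_integrable_def)
  note [measurable] = measurable_component[OF meas(2)]
  fix i :: "'p option"
  show "(\<lambda>\<omega>. state A \<omega> $ i) \<in> borel_measurable M"
    by (cases i) (simp_all add: stack_def)
  have "integrable M (\<lambda>\<omega>. (state A \<omega> $ i)\<^sup>2)"
  proof (cases i)
    case None
    then show ?thesis
      using assms(1) by (simp add: stack_def square_integrable_def)
  next
    case (Some j)
    have "integrable M (\<lambda>\<omega>. (X A \<omega> $ j)\<^sup>2)"
    proof (rule Bochner_Integration.integrable_bound)
      show "integrable M (\<lambda>\<omega>. (norm (X A \<omega>))\<^sup>2)"
        using assms(2) by (simp add: square_integrable_def)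
      show "(\<lambda>\<omega>. (X A \<omega> $ j)\<^sup>2) \<in> borel_measurable M"
        by measurable
      show "AE \<omega> in M. norm ((X A \<omega> $ j)\<^sup>2) \<le> norm ((norm (X A \<omega>))\<^sup>2)"
        by (intro AE_I2) (simp add: abs_le_square_iff[symmetric] component_le_norm_cart)
    qed
    then show ?thesis
      by (simp add: Some stack_def)
  qed
  then show "cond_exp_exists M (sigma_of M B) (\<lambda>\<omega>. (state A \<omega> $ i)\<^sup>2)"
    by (rule cond_exp_exists_integrable)
qed

text \<open>Since $\epsilon_A + A = (I - B) Z$ for the state $Z$, each component is a combination of
  state components whose coefficients are known given $B$. No bound on $B$ is available, so
  the conditional second moments exist although the second moments themselves may not.\<close>

lemma noise_plus_shift_square_exists:
  assumes "A \<in> S" "square_integrable M (Y A)" "square_integrable M (X A)"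
  shows "cond_exp_exists M (sigma_of M B) (\<lambda>\<omega>. ((\<epsilon> A \<omega> + A \<omega>) $ l)\<^sup>2)"
proof -
  let ?r = "\<lambda>\<omega>. (mat 1 - B \<omega>) $ l"
  have "(\<lambda>\<omega>. mat 1 - B \<omega>) \<in> borel_measurable (sigma_of M B)"
    using measurable_sigma_of_B by measurable
  then have "?r \<in> borel_measurable (sigma_of M B)"
    by (rule measurable_compose) (intro borel_measurable_continuous_onI continuous_intros)
  then have "(\<lambda>\<omega>. ?r \<omega> $ j) \<in> borel_measurable (sigma_of M B)" for j
    by (rule measurable_component)
  then have "cond_exp_exists M (sigma_of M B) (\<lambda>\<omega>. (?r \<omega> \<bullet> state A \<omega>) * (?r \<omega> \<bullet> state A \<omega>))"
    by (rule cond_exp_exists_inner_times_inner[OF state_second_moment_exists[OF assms(2,3)]])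
  then show ?thesis
  proof (rule cond_exp_exists_bound)
    show "(\<lambda>\<omega>. ((\<epsilon> A \<omega> + A \<omega>) $ l)\<^sup>2) \<in> borel_measurable M"
      using measurable_noise[OF \<open>A \<in> S\<close>] measurable_shift[OF \<open>A \<in> S\<close>]
      by (intro borel_measurable_power measurable_component) measurable
    show "AE \<omega> in M. \<bar>((\<epsilon> A \<omega> + A \<omega>) $ l)\<^sup>2\<bar> \<le> \<bar>(?r \<omega> \<bullet> state A \<omega>) * (?r \<omega> \<bullet> state A \<omega>)\<bar>"
      using AE_inverse_structural_equation[OF \<open>A \<in> S\<close>]
    proof eventually_elim
      case (elim \<omega>)
      have "?r \<omega> \<bullet> state A \<omega> = (\<epsilon> A \<omega> + A \<omega>) $ l"
        unfolding elim[symmetric] by (simp add: matrix_vector_mul_component)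
      then show ?case
        by (simp add: power2_eq_square)
    qed
  qed
qed

text \<open>For the zero shift, the noise is the noise plus the shift; the common law transfers
  the existence of its second moments to every environment.\<close>

lemma noise_square_exists:
  assumes "A \<in> S" "square_integrable M (Y (\<lambda>_. 0))" "square_integrable M (X (\<lambda>_. 0))"
  shows "cond_exp_exists M (sigma_of M B) (\<lambda>\<omega>. (\<epsilon> A \<omega> $ l)\<^sup>2)"
proof (rule cond_exp_exists_noise_cong[OF zero_shift \<open>A \<in> S\<close>])
  show "(\<lambda>e. (e $ l)\<^sup>2) \<in> borel_measurable (borel :: (real^('p option)) measure)"
    by (intro borel_measurable_power measurable_component measurable_ident_sets refl)
  show "cond_exp_exists M (sigma_of M B) (\<lambda>\<omega>. (\<epsilon> (\<lambda>_. 0) \<omega> $ l)\<^sup>2)"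
    using noise_plus_shift_square_exists[OF zero_shift assms(2,3), of l] by simp
qed

lemma noise_second_moment_exists:
  assumes "A \<in> S" "square_integrable M (Y (\<lambda>_. 0))" "square_integrable M (X (\<lambda>_. 0))"
  shows "mat_cond_exp_exists M (sigma_of M B) (\<lambda>\<omega>. outer (\<epsilon> A \<omega>) (\<epsilon> A \<omega>))"
  using measurable_component[OF measurable_noise[OF \<open>A \<in> S\<close>]]
    noise_square_exists[OF assms]
  by (rule mat_cond_exp_existsI_squares)

lemma shift_second_moment_exists:
  assumes "A \<in> S" "square_integrable M (Y A)" "square_integrable M (X A)"
    and zero: "square_integrable M (Y (\<lambda>_. 0))" "square_integrable M (X (\<lambda>_. 0))"
  shows "mat_cond_exp_exists M (sigma_of M B) (\<lambda>\<omega>. outer (A \<omega>) (A \<omega>))"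
  using measurable_component[OF measurable_shift[OF \<open>A \<in> S\<close>]]
proof (rule mat_cond_exp_existsI_squares)
  fix l
  show "cond_exp_exists M (sigma_of M B) (\<lambda>\<omega>. (A \<omega> $ l)\<^sup>2)"
  proof (rule cond_exp_exists_square_bound
      [OF noise_plus_shift_square_exists[OF assms(1-3)] noise_square_exists[OF \<open>A \<in> S\<close> zero]])
    show "(\<lambda>\<omega>. (A \<omega> $ l)\<^sup>2) \<in> borel_measurable M"
      by (intro borel_measurable_power measurable_component[OF measurable_shift[OF \<open>A \<in> S\<close>]])
    have "\<bar>a\<^sup>2\<bar> \<le> 2 * (e + a)\<^sup>2 + 2 * e\<^sup>2" for a e :: real
      using zero_le_power2[of "2 * e + a"] by (simp add: power2_eq_square algebra_simps)
    then show "AE \<omega> in M. \<bar>(A \<omega> $ l)\<^sup>2\<bar> \<le> 2 * ((\<epsilon> A \<omega> + A \<omega>) $ l)\<^sup>2 + 2 * (\<epsilon> A \<omega> $ l)\<^sup>2"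
      by (intro AE_I2) simp
  qed
qed

text \<open>The row vector $c = (1, -\beta)(I - B)^{-1}$ turns the residual into
  $c \epsilon_A + c A$. Conditionally on $B$, its square has expectation
  $E[(c \epsilon_A)^2 \mid B] + 2\, c\, E[\epsilon_A A^T \mid B]\, c^T + c\, E[A A^T \mid B]\, c^T$.
  The middle term vanishes, and the first integrates to the risk of the zero shift because
  the joint law of the noise and $B$ does not depend on the shift. All integrals are taken
  in $[0, \infty]$, so $A$ may have infinite risk. The vector $c$ depends only on $B$ and
  $\beta$; that the same $c$ serves all shifts is what makes risks comparable.\<close>

lemma risk_decomposition:
  assumes zero: "square_integrable M (Y (\<lambda>_. 0))" "square_integrable M (X (\<lambda>_. 0))"
  obtains c :: "'w \<Rightarrow> real^('p option)"
  where "\<And>A. A \<in> S \<Longrightarrow> mat_cond_exp_exists M (sigma_of M B) (\<lambda>\<omega>. outer (A \<omega>) (A \<omega>)) \<Longrightarrow>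
    risk M (Y A) (X A) \<beta> = risk M (Y (\<lambda>_. 0)) (X (\<lambda>_. 0)) \<beta> +
      (\<integral>\<^sup>+\<omega>. ennreal (c \<omega> \<bullet> (mat_cond_exp M (sigma_of M B) (\<lambda>\<omega>. outer (A \<omega>) (A \<omega>)) \<omega> *v c \<omega>)) \<partial>M)"
proof -
  let ?F = "sigma_of M B"
  obtain g :: "real^('p option)^('p option) \<Rightarrow> real^('p option)"
    where g [measurable]: "g \<in> borel_measurable borel"
      and solve: "\<And>m. rank m = CARD('p option) \<Longrightarrow> g m v* m = stack 1 (- \<beta>)"
    using borel_measurable_left_solution[of "stack 1 (- \<beta>)"] by blast
  define c where "c \<omega> = g (mat 1 - B \<omega>)" for \<omega>
  have cF: "c \<in> borel_measurable ?F"
    unfolding c_def using measurable_sigma_of_B by measurable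
  then have comp: "(\<lambda>\<omega>. c \<omega> $ j) \<in> borel_measurable ?F" for j
    by (rule measurable_component)
  have [measurable]: "c \<in> borel_measurable M"
    by (rule measurable_from_subalg[OF subalg cF])
  note [measurable] = measurable_B
  have residual: "AE \<omega> in M. Y A \<omega> - \<beta> \<bullet> X A \<omega> = c \<omega> \<bullet> \<epsilon> A \<omega> + c \<omega> \<bullet> A \<omega>" if "A \<in> S" for A
    using AE_inverse_structural_equation[OF that] full_rank
  proof eventually_elim
    case (elim \<omega>)
    have "Y A \<omega> - \<beta> \<bullet> X A \<omega> = stack 1 (- \<beta>) \<bullet> state A \<omega>"
      by (simp add: inner_stack)
    also have "\<dots> = c \<omega> \<bullet> ((mat 1 - B \<omega>) *v state A \<omega>)"
      using solve[OF elim(2)] by (simp add: c_def dot_lmul_matrix[symmetric])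
    also have "\<dots> = c \<omega> \<bullet> \<epsilon> A \<omega> + c \<omega> \<bullet> A \<omega>"
      unfolding elim(1) by (simp add: inner_add_right)
    finally show ?case .
  qed
  have noise_risk: "(\<integral>\<^sup>+\<omega>. ennreal ((c \<omega> \<bullet> \<epsilon> A \<omega>) * (c \<omega> \<bullet> \<epsilon> A \<omega>)) \<partial>M)
      = risk M (Y (\<lambda>_. 0)) (X (\<lambda>_. 0)) \<beta>" if "A \<in> S" for A
  proof -
    have "(\<lambda>(e, b). ennreal ((g (mat 1 - b) \<bullet> e) * (g (mat 1 - b) \<bullet> e))) \<in> borel_measurable (borel \<Otimes>\<^sub>M borel)"
      by measurable
    from nn_integral_noise_cong[OF that zero_shift this]
    have "(\<integral>\<^sup>+\<omega>. ennreal ((c \<omega> \<bullet> \<epsilon> A \<omega>) * (c \<omega> \<bullet> \<epsilon> A \<omega>)) \<partial>M)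
        = (\<integral>\<^sup>+\<omega>. ennreal ((c \<omega> \<bullet> \<epsilon> (\<lambda>_. 0) \<omega>) * (c \<omega> \<bullet> \<epsilon> (\<lambda>_. 0) \<omega>)) \<partial>M)"
      by (simp add: c_def)
    also have "\<dots> = risk M (Y (\<lambda>_. 0)) (X (\<lambda>_. 0)) \<beta>"
      unfolding risk_def using residual[OF zero_shift]
      by (intro nn_integral_cong_AE) (auto simp: power2_eq_square elim!: eventually_mono)
    finally show ?thesis .
  qed
  show thesis
  proof (rule that[of c])
    fix A
    assume A: "A \<in> S" and ex: "mat_cond_exp_exists M ?F (\<lambda>\<omega>. outer (A \<omega>) (A \<omega>))"
    note [measurable] = measurable_noise[OF A] measurable_shift[OF A]
    let ?a = "\<lambda>\<omega>. (c \<omega> \<bullet> \<epsilon> A \<omega>) * (c \<omega> \<bullet> \<epsilon> A \<omega>)"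
    let ?b = "\<lambda>\<omega>. (c \<omega> \<bullet> \<epsilon> A \<omega>) * (c \<omega> \<bullet> A \<omega>)"
    let ?d = "\<lambda>\<omega>. (c \<omega> \<bullet> A \<omega>) * (c \<omega> \<bullet> A \<omega>)"
    let ?q = "\<lambda>\<omega>. c \<omega> \<bullet> (mat_cond_exp M ?F (\<lambda>\<omega>. outer (A \<omega>) (A \<omega>)) \<omega> *v c \<omega>)"
    note a = cond_exp_exists_inner_times_inner[OF noise_second_moment_exists[OF A zero] comp]
    note b = cond_exp_exists_inner_times_inner[OF uncorrelated_exists[OF A] comp]
    note d = cond_exp_exists_inner_times_inner[OF ex comp]
    note b2 = cond_exp_exists_weight[OF b, of "\<lambda>_. 2", OF borel_measurable_const]
    note sum = cond_exp_exists_add[OF a cond_exp_exists_add[OF b2 d]]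
    \<comment> \<open>The cross term is a quadratic form of the zero matrix.\<close>
    have b0: "AE \<omega> in M. real_cond_exp M ?F (\<lambda>\<omega>. 2 * ?b \<omega>) \<omega> = 0"
      using real_cond_exp_weight[OF b, of "\<lambda>_. 2", OF borel_measurable_const]
        real_cond_exp_inner_times_inner[OF uncorrelated_exists[OF A] comp] uncorrelated[OF A]
      by eventually_elim simp
    have dq: "AE \<omega> in M. real_cond_exp M ?F ?d \<omega> = ?q \<omega>"
      by (rule real_cond_exp_inner_times_inner[OF ex comp])
    have nonneg: "AE \<omega> in M. 0 \<le> real_cond_exp M ?F ?a \<omega> \<and> 0 \<le> ?q \<omega>"
      using ennreal_real_cond_exp[OF a] ennreal_real_cond_exp[OF d] dq by auto
    have total: "AE \<omega> in M. real_cond_exp M ?F (\<lambda>\<omega>. ?a \<omega> + (2 * ?b \<omega> + ?d \<omega>)) \<omega>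
        = real_cond_exp M ?F ?a \<omega> + ?q \<omega>"
      using real_cond_exp_add_generalized[OF a cond_exp_exists_add[OF b2 d]]
        real_cond_exp_add_generalized[OF b2 d] b0 dq
      by eventually_elim simp
    have square: "?a \<omega> + (2 * ?b \<omega> + ?d \<omega>) = (c \<omega> \<bullet> \<epsilon> A \<omega> + c \<omega> \<bullet> A \<omega>)\<^sup>2" for \<omega>
      by (simp add: power2_eq_square algebra_simps)
    \<comment> \<open>Additivity of the nonnegative integral needs the quadratic form to be measurable,
      which is visible only after expanding it into entries.\<close>
    have q_meas: "(\<lambda>\<omega>. ennreal (?q \<omega>)) \<in> borel_measurable M"
      using measurable_from_subalg[OF subalg comp]
      unfolding inner_vec_def matrix_vector_mult_def mat_cond_exp_def by simp
    have "risk M (Y A) (X A) \<beta> = (\<integral>\<^sup>+\<omega>. ennreal (?a \<omega> + (2 * ?b \<omega> + ?d \<omega>)) \<partial>M)"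
      unfolding risk_def square using residual[OF A]
      by (intro nn_integral_cong_AE) (auto elim!: eventually_mono)
    also have "\<dots> = (\<integral>\<^sup>+\<omega>. ennreal (real_cond_exp M ?F (\<lambda>\<omega>. ?a \<omega> + (2 * ?b \<omega> + ?d \<omega>)) \<omega>) \<partial>M)"
      by (rule nn_integral_real_cond_exp[OF sum, symmetric]) (simp add: square)
    also have "\<dots> = (\<integral>\<^sup>+\<omega>. ennreal (real_cond_exp M ?F ?a \<omega>) + ennreal (?q \<omega>) \<partial>M)"
    proof (rule nn_integral_cong_AE)
      show "AE \<omega> in M. ennreal (real_cond_exp M ?F (\<lambda>\<omega>. ?a \<omega> + (2 * ?b \<omega> + ?d \<omega>)) \<omega>)
          = ennreal (real_cond_exp M ?F ?a \<omega>) + ennreal (?q \<omega>)"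
        using total nonneg by eventually_elim simp
    qed
    also have "\<dots> = (\<integral>\<^sup>+\<omega>. ennreal (real_cond_exp M ?F ?a \<omega>) \<partial>M) + (\<integral>\<^sup>+\<omega>. ennreal (?q \<omega>) \<partial>M)"
      using q_meas by (intro nn_integral_add) auto
    also have "(\<integral>\<^sup>+\<omega>. ennreal (real_cond_exp M ?F ?a \<omega>) \<partial>M) = (\<integral>\<^sup>+\<omega>. ennreal (?a \<omega>) \<partial>M)"
      by (rule nn_integral_real_cond_exp[OF a]) simp
    finally show "risk M (Y A) (X A) \<beta> = risk M (Y (\<lambda>_. 0)) (X (\<lambda>_. 0)) \<beta> + (\<integral>\<^sup>+\<omega>. ennreal (?q \<omega>) \<partial>M)"
      unfolding noise_risk[OF A] .
  qed
qed

lemma risk_mono_second_moment: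
  assumes "square_integrable M (Y (\<lambda>_. 0))" "square_integrable M (X (\<lambda>_. 0))"
    and S: "A \<in> S" "A' \<in> S" and le: "second_moment_le M (sigma_of M B) A A'"
  shows "risk M (Y A) (X A) \<beta> \<le> risk M (Y A') (X A') \<beta>"
proof -
  let ?E = "\<lambda>A. mat_cond_exp M (sigma_of M B) (\<lambda>\<omega>. outer (A \<omega>) (A \<omega>))"
  obtain c where c: "\<And>A. A \<in> S \<Longrightarrow> mat_cond_exp_exists M (sigma_of M B) (\<lambda>\<omega>. outer (A \<omega>) (A \<omega>)) \<Longrightarrow>
    risk M (Y A) (X A) \<beta> = risk M (Y (\<lambda>_. 0)) (X (\<lambda>_. 0)) \<beta> + (\<integral>\<^sup>+\<omega>. ennreal (c \<omega> \<bullet> (?E A \<omega> *v c \<omega>)) \<partial>M)"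
    using risk_decomposition[OF assms(1,2), of \<beta>] by blast
  have "AE \<omega> in M. loewner_le (?E A \<omega>) (?E A' \<omega>)"
    using le by (simp add: second_moment_le_def)
  then have "AE \<omega> in M. c \<omega> \<bullet> (?E A \<omega> *v c \<omega>) \<le> c \<omega> \<bullet> (?E A' \<omega> *v c \<omega>)"
  proof eventually_elim
    case (elim \<omega>)
    then have "0 \<le> c \<omega> \<bullet> ((?E A' \<omega> - ?E A \<omega>) *v c \<omega>)"
      by (simp add: loewner_le_def pos_semidef_def)
    then show ?case
      by (simp add: matrix_vector_mult_diff_rdistrib inner_diff_right)
  qed
  then have "(\<integral>\<^sup>+\<omega>. ennreal (c \<omega> \<bullet> (?E A \<omega> *v c \<omega>)) \<partial>M) \<le> (\<integral>\<^sup>+\<omega>. ennreal (c \<omega> \<bullet> (?E A' \<omega> *v c \<omega>)) \<partial>M)"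
    by (intro nn_integral_mono_AE) (auto elim!: eventually_mono intro: ennreal_leI)
  then show ?thesis
    using le S by (simp add: c second_moment_le_def add_left_mono)
qed

text \<open>With the existence of the second moments, this puts each reference shift into the
  robustness set, which gives the lower bound on the supremum.\<close>

lemma second_moment_le_refl:
  assumes "mat_cond_exp_exists M (sigma_of M B) (\<lambda>\<omega>. outer (A \<omega>) (A \<omega>))"
  shows "second_moment_le M (sigma_of M B) A A"
  using assms by (simp add: second_moment_le_def loewner_le_def pos_semidef_def transpose_def vec_eq_iff)

end

theorem proposition3:
  fixes M :: "'w measure"
    and B :: "'w \<Rightarrow> real^('p::finite option)^('p option)"
    and S \<A> :: "('w \<Rightarrow> real^('p option)) set"
    and \<epsilon> :: "('w \<Rightarrow> real^('p option)) \<Rightarrow> 'w \<Rightarrow> real^('p option)"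
    and Y :: "('w \<Rightarrow> real^('p option)) \<Rightarrow> 'w \<Rightarrow> real"
    and X :: "('w \<Rightarrow> real^('p option)) \<Rightarrow> 'w \<Rightarrow> real^'p"
    and k :: nat
    and A :: "nat \<Rightarrow> 'w \<Rightarrow> real^('p option)"
    and \<beta> :: "real^'p"
  assumes "random_sem M B S \<epsilon> Y X"
    and "1 \<le> k"
    and "\<A> \<subseteq> S"
    and "\<And>i. i \<in> {1..k} \<Longrightarrow> A i \<in> \<A>"
    and "\<And>i. i \<in> {1..k} \<Longrightarrow> square_integrable M (Y (A i))"
    and "\<And>i. i \<in> {1..k} \<Longrightarrow> square_integrable M (X (A i))"
    and "square_integrable M (Y (\<lambda>_. 0))"
    and "square_integrable M (X (\<lambda>_. 0))"
  shows "(SUP A'\<in>shift_set M B \<A> k A. risk M (Y A') (X A') \<beta>) =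
         (MAX i\<in>{1..k}. risk M (Y (A i)) (X (A i)) \<beta>)"
proof -
  interpret random_sem M B S \<epsilon> Y X by fact
  note zero = assms(7,8)
  let ?R = "\<lambda>A. risk M (Y A) (X A) \<beta>"
  have in_S: "A i \<in> S" if "i \<in> {1..k}" for i
    using assms(3,4) that by blast
  have "A i \<in> shift_set M B \<A> k A" if "i \<in> {1..k}" for i
    using second_moment_le_refl[OF shift_second_moment_exists[OF in_S[OF that] assms(5,6)[OF that] zero]]
      assms(4)[OF that] that
    by (auto simp: shift_set_def)
  then have upper: "?R (A i) \<le> (SUP A'\<in>shift_set M B \<A> k A. ?R A')" if "i \<in> {1..k}" for i
    using that by (intro SUP_upper) auto
  have "?R A' \<le> (MAX i\<in>{1..k}. ?R (A i))" if "A' \<in> shift_set M B \<A> k A" for A'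
  proof -
    from that obtain i where i: "i \<in> {1..k}" and A': "A' \<in> S"
      and le: "second_moment_le M (sigma_of M B) A' (A i)"
      using assms(3) by (auto simp: shift_set_def)
    have "?R A' \<le> ?R (A i)"
      using zero A' in_S[OF i] le by (rule risk_mono_second_moment)
    also have "\<dots> \<le> (MAX i\<in>{1..k}. ?R (A i))"
      using i by (intro Max_ge) auto
    finally show ?thesis .
  qed
  then show ?thesis
    using upper assms(2) by (intro antisym SUP_least Max.boundedI) auto
qed

end
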